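(* For all integers $m,n$ larger than $1$, let $G_{m,n}$ be the group generated by the following transformations of the real line: $c:x\mapsto x+1$, $b:x\mapsto mx$, $a:x\mapsto \mathrm{sgn}(x)|x|^{n}$. Then $G_{m,n}$ does not embed into the group of orientation-preserving $C^1$ diffeomorphisms of the closed interval.
   Context: The group $G_{m,n}$ is the subgroup generated by $a,b,c$ inside the group of orientation-preserving homeomorphisms of $\mathbb{R}$ under composition. All actions in the paper are by orientation-preserving maps. *)

theory Defs
  imports "HOL-Analysis.Analysis" "HOL-Algebra.Bij" "HOL-Algebra.Generated_Groups"
begin

text \<open>Both ambient groups are subgroups of the library's group \<^term>\<open>BijGroup S\<close> of
  bijections of \<open>S\<close> under composition. An element of \<^term>\<open>BijGroup S\<close> is an
  extensional function, i.e. it takes the value \<^term>\<open>undefined\<close> outside \<open>S\<close>.\<close>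

definition homeo_plus :: "(real \<Rightarrow> real) set" where
  "homeo_plus = {f \<in> Bij UNIV. homeomorphism UNIV UNIV f (inv_into UNIV f) \<and> strict_mono f}"

definition Homeo_plus :: "(real \<Rightarrow> real) monoid" where
  "Homeo_plus = (BijGroup UNIV)\<lparr>carrier := homeo_plus\<rparr>"

text \<open>Derivatives are taken within the interval, hence are one-sided at the endpoints. (The
  library's \<open>C1_differentiable_on\<close> takes two-sided derivatives, so at the endpoints it
  would depend on the values outside the interval.)\<close>

definition C1_on_interval :: "(real \<Rightarrow> real) \<Rightarrow> bool" where
  "C1_on_interval f \<longleftrightarrow>
     (\<exists>f'. (\<forall>x\<in>{0..1}. (f has_real_derivative f' x) (at x within {0..1})) \<and>
           continuous_on {0..1} f')"

definition diff1_plus :: "(real \<Rightarrow> real) set" where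
  "diff1_plus = {f \<in> Bij {0..1}. C1_on_interval f \<and> C1_on_interval (inv_into {0..1} f) \<and>
     strict_mono_on {0..1} f}"

definition Diff1_plus :: "(real \<Rightarrow> real) monoid" where
  "Diff1_plus = (BijGroup {0..1})\<lparr>carrier := diff1_plus\<rparr>"

definition gen_a :: "nat \<Rightarrow> real \<Rightarrow> real" where
  "gen_a n = (\<lambda>x. sgn x * \<bar>x\<bar> ^ n)"

definition gen_b :: "nat \<Rightarrow> real \<Rightarrow> real" where
  "gen_b m = (\<lambda>x. real m * x)"

definition gen_c :: "real \<Rightarrow> real" where
  "gen_c = (\<lambda>x. x + 1)"

definition G_mn :: "nat \<Rightarrow> nat \<Rightarrow> (real \<Rightarrow> real) monoid" where
  "G_mn m n = subgroup_generated Homeo_plus {gen_a n, gen_b m, gen_c}"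


text \<open>The ambient structures are groups, and the three generators belong to the first one
  (\<^const>\<open>subgroup_generated\<close> silently discards generators outside the carrier).\<close>

lemma BijGroup_inv:
  assumes "f \<in> Bij S"
  shows "inv\<^bsub>BijGroup S\<^esub> f = restrict (inv_into S f) S"
proof (rule group.inv_equality[OF group_BijGroup])
  show "restrict (inv_into S f) S \<otimes>\<^bsub>BijGroup S\<^esub> f = \<one>\<^bsub>BijGroup S\<^esub>"
    using assms Bij_compose_restrict_eq[OF assms] restrict_inv_into_Bij[OF assms]
    by (simp add: BijGroup_def)
qed (use assms restrict_inv_into_Bij[OF assms] in \<open>simp_all add: BijGroup_def\<close>)

lemma subgroup_homeo_plus: "subgroup homeo_plus (BijGroup UNIV)"
proof (rule group.subgroupI[OF group_BijGroup])
  show "homeo_plus \<subseteq> carrier (BijGroup UNIV)"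
    by (auto simp: homeo_plus_def BijGroup_def)
  have "id \<in> homeo_plus"
    by (auto simp: homeo_plus_def homeomorphism_def strict_mono_def Bij_def)
  then show "homeo_plus \<noteq> {}"
    by blast
next
  fix f assume f: "f \<in> homeo_plus"
  then have fB: "f \<in> Bij UNIV" and h: "homeomorphism UNIV UNIV f (inv_into UNIV f)"
    and mono: "strict_mono f" and bij: "bij f"
    by (auto simp: homeo_plus_def Bij_def)
  have "strict_mono (inv_into UNIV f)"
  proof (rule strict_monoI)
    fix x y :: real assume "x < y"
    then have "f (inv_into UNIV f x) < f (inv_into UNIV f y)"
      using bij by (simp add: bij_is_surj surj_f_inv_f)
    then show "inv_into UNIV f x < inv_into UNIV f y"
      using mono by (simp add: strict_mono_less)
  qed
  moreover have "homeomorphism UNIV UNIV (inv_into UNIV f) (inv_into UNIV (inv_into UNIV f))"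
    using homeomorphism_symD[OF h] inv_inv_eq[OF bij] by simp
  ultimately show "inv\<^bsub>BijGroup UNIV\<^esub> f \<in> homeo_plus"
    using bij bij_imp_bij_inv[OF bij] by (simp add: BijGroup_inv[OF fB] homeo_plus_def Bij_def restrict_def)
next
  fix f g assume fg: "f \<in> homeo_plus" "g \<in> homeo_plus"
  then have B: "f \<in> Bij UNIV" "g \<in> Bij UNIV" and bij: "bij f" "bij g"
    by (auto simp: homeo_plus_def Bij_def)
  have eq: "f \<otimes>\<^bsub>BijGroup UNIV\<^esub> g = f \<circ> g"
    using B by (simp add: BijGroup_def compose_def fun_eq_iff)
  have "homeomorphism UNIV UNIV (f \<circ> g) (inv_into UNIV g \<circ> inv_into UNIV f)"
    using fg by (auto simp: homeo_plus_def intro: homeomorphism_compose)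
  then have "homeomorphism UNIV UNIV (f \<circ> g) (inv_into UNIV (f \<circ> g))"
    using bij by (simp add: o_inv_distrib)
  moreover have "strict_mono (f \<circ> g)"
    using fg by (auto simp: homeo_plus_def strict_mono_def)
  ultimately show "f \<otimes>\<^bsub>BijGroup UNIV\<^esub> g \<in> homeo_plus"
    unfolding eq using bij by (simp add: homeo_plus_def Bij_def bij_comp)
qed

lemma C1_on_interval_cong:
  assumes "C1_on_interval f" "\<And>x. x \<in> {0..1} \<Longrightarrow> f x = g x"
  shows "C1_on_interval g"
proof -
  have "(g has_real_derivative D) (at x within {0..1})"
    if "(f has_real_derivative D) (at x within {0..1})" "x \<in> {0..1}" for x D
    using has_field_derivative_transform_within[OF that(1) zero_less_one that(2)] assms(2) by blast
  with assms(1) show ?thesis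
    unfolding C1_on_interval_def by meson
qed

lemma C1_on_interval_compose:
  assumes f: "C1_on_interval f" and g: "C1_on_interval g" and im: "g ` {0..1} \<subseteq> {0..1}"
  shows "C1_on_interval (f \<circ> g)"
proof -
  obtain f' where f': "\<And>x. x \<in> {0..1} \<Longrightarrow> (f has_real_derivative f' x) (at x within {0..1})"
    and cf: "continuous_on {0..1} f'"
    using f unfolding C1_on_interval_def by blast
  obtain g' where g': "\<And>x. x \<in> {0..1} \<Longrightarrow> (g has_real_derivative g' x) (at x within {0..1})"
    and cg: "continuous_on {0..1} g'"
    using g unfolding C1_on_interval_def by blast
  have "(f \<circ> g has_real_derivative f' (g x) * g' x) (at x within {0..1})" if x: "x \<in> {0..1}" for x
  proof (rule DERIV_image_chain)
    show "(f has_real_derivative f' (g x)) (at (g x) within g ` {0..1})"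
      using f'[of "g x"] im x by (blast intro: has_field_derivative_subset)
  qed (rule g'[OF x])
  moreover have "continuous_on {0..1} g"
    using g' by (rule DERIV_continuous_on)
  then have "continuous_on {0..1} (\<lambda>x. f' (g x) * g' x)"
    by (intro continuous_intros cg continuous_on_compose2[OF cf]) (use im in auto)
  ultimately show ?thesis
    unfolding C1_on_interval_def by (intro exI[of _ "\<lambda>x. f' (g x) * g' x"]) auto
qed

lemma subgroup_diff1_plus: "subgroup diff1_plus (BijGroup {0..1})"
proof (rule group.subgroupI[OF group_BijGroup])
  show "diff1_plus \<subseteq> carrier (BijGroup {0..1})"
    by (auto simp: diff1_plus_def BijGroup_def)
  let ?I = "\<lambda>x\<in>{0..1::real}. x"
  have id: "C1_on_interval (\<lambda>x. x)"
    unfolding C1_on_interval_def by (intro exI[of _ "\<lambda>_. 1"]) auto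
  have I: "?I \<in> Bij {0..1}"
    by (rule id_Bij)
  have "inv_into {0..1} ?I x = x" if "x \<in> {0..1}" for x
    using that I by (intro inv_into_f_eq) (auto simp: Bij_def bij_betw_def)
  then have "C1_on_interval ?I" "C1_on_interval (inv_into {0..1} ?I)"
    using id by (auto intro: C1_on_interval_cong)
  then have "?I \<in> diff1_plus"
    using I by (auto simp: diff1_plus_def strict_mono_on_def)
  then show "diff1_plus \<noteq> {}"
    by blast
next
  fix f assume f: "f \<in> diff1_plus"
  then have fB: "f \<in> Bij {0..1}" and bij: "bij_betw f {0..1} {0..1}"
    and mono: "strict_mono_on {0..1} f"
    by (auto simp: diff1_plus_def Bij_def)
  let ?g = "restrict (inv_into {0..1} f) {0..1}"
  have gB: "?g \<in> Bij {0..1}"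
    by (rule restrict_inv_into_Bij[OF fB])
  have "strict_mono_on {0..1} ?g"
  proof (rule strict_mono_onI)
    fix x y :: real assume xy: "x \<in> {0..1}" "y \<in> {0..1}" "x < y"
    then have "?g x \<in> {0..1}" "?g y \<in> {0..1}" "f (?g x) = x" "f (?g y) = y"
      using bij Bij_inv_into_mem[OF fB] by (auto simp: bij_betw_inv_into_right)
    then show "?g x < ?g y"
      using mono xy(3) by (metis strict_mono_on_less)
  qed
  moreover have "C1_on_interval ?g"
    by (rule C1_on_interval_cong[of "inv_into {0..1} f"]) (use f in \<open>auto simp: diff1_plus_def\<close>)
  moreover
  have eq: "inv_into {0..1} ?g x = f x" if "x \<in> {0..1}" for x
    using that bij gB
    by (intro inv_into_f_eq)
      (auto simp: Bij_def bij_betw_def bij_betw_inv_into_left[OF bij])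
  have "C1_on_interval (inv_into {0..1} ?g)"
    by (rule C1_on_interval_cong[of f]) (use f in \<open>simp_all add: diff1_plus_def eq del: atLeastAtMost_iff\<close>)
  ultimately show "inv\<^bsub>BijGroup {0..1}\<^esub> f \<in> diff1_plus"
    using gB by (simp add: BijGroup_inv[OF fB] diff1_plus_def)
next
  fix f g assume fg: "f \<in> diff1_plus" "g \<in> diff1_plus"
  then have B: "f \<in> Bij {0..1}" "g \<in> Bij {0..1}"
    and bij: "bij_betw f {0..1} {0..1}" "bij_betw g {0..1} {0..1}"
    by (auto simp: diff1_plus_def Bij_def)
  let ?h = "compose {0..1} f g"
  have hB: "?h \<in> Bij {0..1}"
    by (rule compose_Bij[OF B])
  have gim: "g x \<in> {0..1}" if "x \<in> {0..1}" for x
    using bij(2) that by (rule bij_betwE[rule_format])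
  have "strict_mono_on {0..1} ?h"
    using fg gim by (auto simp: diff1_plus_def strict_mono_on_def compose_def)
  moreover have "C1_on_interval ?h"
  proof (rule C1_on_interval_cong[of "f \<circ> g"])
    show "C1_on_interval (f \<circ> g)"
      using fg gim by (intro C1_on_interval_compose) (auto simp: diff1_plus_def)
  qed (simp add: compose_def)
  moreover have "C1_on_interval (inv_into {0..1} ?h)"
  proof (rule C1_on_interval_cong[of "inv_into {0..1} g \<circ> inv_into {0..1} f"])
    show "C1_on_interval (inv_into {0..1} g \<circ> inv_into {0..1} f)"
      using fg Bij_inv_into_mem[OF B(1)]
      by (intro C1_on_interval_compose) (auto simp: diff1_plus_def simp del: atLeastAtMost_iff)
    fix x :: real assume x: "x \<in> {0..1}"
    let ?y = "inv_into {0..1} f x"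
    have y: "?y \<in> {0..1}"
      by (rule Bij_inv_into_mem[OF B(1) x])
    have z: "inv_into {0..1} g ?y \<in> {0..1}"
      by (rule Bij_inv_into_mem[OF B(2) y])
    have "?h (inv_into {0..1} g ?y) = x"
      using z by (simp only: compose_eq bij_betw_inv_into_right[OF bij(2) y]
          bij_betw_inv_into_right[OF bij(1) x])
    moreover have "inj_on ?h {0..1}"
      using hB by (simp add: Bij_def bij_betw_def)
    ultimately show "(inv_into {0..1} g \<circ> inv_into {0..1} f) x = inv_into {0..1} ?h x"
      using z by (metis comp_apply inv_into_f_f)
  qed
  ultimately show "f \<otimes>\<^bsub>BijGroup {0..1}\<^esub> g \<in> diff1_plus"
    using B hB by (simp add: BijGroup_def diff1_plus_def)
qed

lemma group_Homeo_plus: "group Homeo_plus"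
  unfolding Homeo_plus_def
  by (rule subgroup.subgroup_is_group[OF subgroup_homeo_plus group_BijGroup])

lemma group_Diff1_plus: "group Diff1_plus"
  unfolding Diff1_plus_def
  by (rule subgroup.subgroup_is_group[OF subgroup_diff1_plus group_BijGroup])

lemma homeo_plusI:
  assumes f: "strict_mono f" and "continuous_on UNIV f" "continuous_on UNIV g" "\<And>x. f (g x) = x"
  shows "f \<in> homeo_plus"
proof -
  have "inj f"
    using f by (rule strict_mono_imp_inj_on)
  moreover have "surj f"
    using assms(4) by (metis surj_def)
  moreover have "inv_into UNIV f = g"
    using \<open>inj f\<close> assms(4) by (intro ext inv_f_eq)
  ultimately show ?thesis
    using assms surj_imp_inj_inv
    by (simp add: homeo_plus_def Bij_def bij_def homeomorphism_def inj_imp_surj_inv flip: \<open>inv_into UNIV f = g\<close>)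
qed

lemma generators_in_Homeo_plus:
  assumes "m > 1" "n > 1"
  shows "{gen_a n, gen_b m, gen_c} \<subseteq> carrier Homeo_plus"
proof -
  have "gen_c \<in> homeo_plus"
    by (rule homeo_plusI[of _ "\<lambda>x. x - 1"])
      (auto simp: gen_c_def strict_mono_def intro!: continuous_intros)
  moreover have "gen_b m \<in> homeo_plus"
    using assms by (intro homeo_plusI[of _ "\<lambda>x. x / real m"])
      (auto simp: gen_b_def strict_mono_def intro!: continuous_intros)
  moreover have "gen_a n \<in> homeo_plus"
  proof (rule homeo_plusI[of _ "root n"])
    have n: "n > 0" using assms by simp
    have inv: "root n (gen_a n x) = x" for x
      using n root_sgn_power[of n x] by (simp add: gen_a_def)
    show "gen_a n (root n x) = x" for x
      using n sgn_power_root[of n x] by (simp add: gen_a_def)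
    show "strict_mono (gen_a n)"
      by (rule strict_monoI) (metis inv n real_root_less_iff)
    show "continuous_on UNIV (root n)"
      by (intro continuous_intros)
    have "gen_a n = (\<lambda>x. x * \<bar>x\<bar> ^ (n - 1))"
      using n by (cases n) (auto simp: gen_a_def fun_eq_iff mult.assoc[symmetric] sgn_mult_abs)
    then show "continuous_on UNIV (gen_a n)"
      by (auto intro!: continuous_intros)
  qed
  ultimately show ?thesis
    by (simp add: Homeo_plus_def)
qed

end

theory Submission
  imports Defs
begin

text \<open>The generators satisfy \<open>b c = c\<^sup>m b\<close> and \<open>a b = b\<^sup>n a\<close>, and these relations alone force \<open>c\<close> to act
  trivially on the closed interval by \<open>C\<^sup>1\<close> diffeomorphisms. If \<open>c\<close> moves a point \<open>x\<close>, then \<open>b\<^sup>-\<^sup>k x\<close> converges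
  to a fixed point \<open>q\<close> of \<open>b\<close>. Comparing lengths of the images of a fundamental domain of \<open>c\<close> under the
  maps \<open>b\<^sup>-\<^sup>k c\<^sup>j\<close> with \<open>j < m\<^sup>k\<close> shows first that \<open>c\<close> moves \<open>q\<close> and then that \<open>b'(q) > 1\<close>. But \<open>a\<^sup>-\<^sup>1\<close>
  permutes the fixed points of \<open>b\<close> and raises the derivative of \<open>b\<close> there to its \<open>n\<close>-th power, so the
  maximum of \<open>b'\<close> over the compact fixed point set cannot exceed \<open>1\<close>.\<close>

section \<open>C^1 diffeomorphisms of the closed unit interval\<close>

locale C1_diffeo =
  fixes f g df dg :: "real \<Rightarrow> real"
  assumes f_mem: "x \<in> {0..1} \<Longrightarrow> f x \<in> {0..1}"
    and g_mem: "x \<in> {0..1} \<Longrightarrow> g x \<in> {0..1}"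
    and g_f: "x \<in> {0..1} \<Longrightarrow> g (f x) = x"
    and f_g: "x \<in> {0..1} \<Longrightarrow> f (g x) = x"
    and f_less: "x \<in> {0..1} \<Longrightarrow> y \<in> {0..1} \<Longrightarrow> x < y \<Longrightarrow> f x < f y"
    and deriv_f: "x \<in> {0..1} \<Longrightarrow> (f has_real_derivative df x) (at x within {0..1})"
    and deriv_g: "x \<in> {0..1} \<Longrightarrow> (g has_real_derivative dg x) (at x within {0..1})"
    and cont_df: "continuous_on {0..1} df"
    and cont_dg: "continuous_on {0..1} dg"

lemma at_within_unit_interval_neq_bot: "x \<in> {0..1::real} \<Longrightarrow> at x within {0..1} \<noteq> bot"
  by (simp add: trivial_limit_within islimpt_Icc)

text \<open>No point of the interval is isolated in it, so difference quotients have at most one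
  limit, also at the endpoints.\<close>

lemma has_real_derivative_unique_unit_interval:
  assumes "(f has_real_derivative D) (at x within {0..1})"
    and "(f has_real_derivative E) (at x within {0..1})" and "x \<in> {0..1}"
  shows "D = E"
  using assms tendsto_unique[OF at_within_unit_interval_neq_bot[OF assms(3)]]
  by (auto simp: has_field_derivative_iff)

lemma has_real_derivative_compose_within:
  assumes "(f has_real_derivative D) (at (g x) within S)"
    and "(g has_real_derivative E) (at x within S)" and "g ` S \<subseteq> S"
  shows "((\<lambda>x. f (g x)) has_real_derivative D * E) (at x within S)"
  using DERIV_image_chain[OF has_field_derivative_subset[OF assms(1,3)] assms(2)]
  by (simp add: o_def)

lemma continuous_on_eventually_less:
  fixes h :: "real \<Rightarrow> real"
  assumes "continuous_on S h" "w \<in> S" "r < h w"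
  obtains \<delta> where "\<delta> > 0" "\<And>y. y \<in> S \<Longrightarrow> \<bar>y - w\<bar> < \<delta> \<Longrightarrow> r < h y"
proof -
  obtain \<delta> where "\<delta> > 0" "\<And>y. y \<in> S \<Longrightarrow> dist y w < \<delta> \<Longrightarrow> dist (h y) (h w) < h w - r"
    using assms unfolding continuous_on_iff by (metis diff_gt_0_iff_gt)
  then show thesis
    by (intro that[of \<delta>]) (auto simp: dist_real_def abs_less_iff)
qed

text \<open>A geometric sequence of ratio greater than 1 is unbounded. Both length comparisons below
  end in this contradiction, with \<open>r\<close> the growth rate per step.\<close>

lemma power_times_unbounded:
  fixes r e M :: real
  assumes "r > 1" "e > 0" "\<And>k. r ^ k * e \<le> M"
  shows False
proof -
  obtain k where "M / e < r ^ k"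
    using real_arch_pow[OF assms(1)] by blast
  then show False
    using assms(2) assms(3)[of k] by (simp add: field_simps)
qed

context C1_diffeo
begin

text \<open>The inverse and its derivative are parameters of the locale, so that this exchange makes
  every result on \<open>f\<close> available for \<open>g\<close>.\<close>

lemma inverse: "C1_diffeo g f dg df"
proof unfold_locales
  fix x y :: real
  assume xy: "x \<in> {0..1}" "y \<in> {0..1}" "x < y"
  show "g x < g y"
  proof (rule ccontr)
    assume "\<not> g x < g y"
    then consider "g y < g x" | "g x = g y" by fastforce
    then show False
      using f_less[OF g_mem[OF xy(2)] g_mem[OF xy(1)]] f_g[OF xy(1)] f_g[OF xy(2)] xy(3)
      by cases auto
  qed
qed (fact f_mem g_mem g_f f_g deriv_f deriv_g cont_df cont_dg)+

lemma f_le: "x \<in> {0..1} \<Longrightarrow> y \<in> {0..1} \<Longrightarrow> x \<le> y \<Longrightarrow> f x \<le> f y"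
  using f_less[of x y] by (cases "x = y") auto

lemma g_greater: "x \<in> {0..1} \<Longrightarrow> f x < x \<Longrightarrow> x < g x"
  using C1_diffeo.f_less[OF inverse f_mem, of x x] g_f by simp

lemma funpow_mem: "x \<in> {0..1} \<Longrightarrow> (f ^^ k) x \<in> {0..1}"
  by (induction k) (auto intro: f_mem simp del: atLeastAtMost_iff)

lemma funpow_le: "x \<in> {0..1} \<Longrightarrow> y \<in> {0..1} \<Longrightarrow> x \<le> y \<Longrightarrow> (f ^^ k) x \<le> (f ^^ k) y"
  by (induction k) (simp_all add: f_le funpow_mem del: atLeastAtMost_iff)

lemma funpow_fixed: "f x = x \<Longrightarrow> (f ^^ k) x = x"
  by (induction k) simp_all

lemma funpow_inverse: "x \<in> {0..1} \<Longrightarrow> (g ^^ k) ((f ^^ k) x) = x"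
proof (induction k)
  case (Suc k)
  have "(g ^^ Suc k) ((f ^^ Suc k) x) = (g ^^ k) (g (f ((f ^^ k) x)))"
    by (simp add: funpow_swap1)
  then show ?case
    using Suc g_f[OF funpow_mem[OF Suc.prems]] by simp
qed simp

lemma f_image: "f ` {0..1} \<subseteq> {0..1}"
  using f_mem by blast

lemma deriv_product:
  assumes x: "x \<in> {0..1}"
  shows "dg (f x) * df x = 1"
proof (rule has_real_derivative_unique_unit_interval[OF _ _ x])
  show "((\<lambda>x. g (f x)) has_real_derivative dg (f x) * df x) (at x within {0..1})"
    by (intro has_real_derivative_compose_within deriv_f deriv_g f_image f_mem x)
  show "((\<lambda>x. g (f x)) has_real_derivative 1) (at x within {0..1})"
    by (rule has_field_derivative_transform_within[OF DERIV_ident zero_less_one x]) (simp add: g_f)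
qed

lemma cont_f: "continuous_on {0..1} f"
  using deriv_f by (rule DERIV_continuous_on)

lemma mvt:
  assumes "x \<in> {0..1}" "y \<in> {0..1}" "x \<le> y"
  obtains z where "x \<le> z" "z \<le> y" "f y - f x = df z * (y - x)"
proof -
  have "(f has_derivative (*) (df z)) (at z within {x..y})" if "x \<le> z" "z \<le> y" for z
    using deriv_f[of z] has_field_derivative_subset[of f "df z" z "{0..1}" "{x..y}"] assms that
    by (auto simp: has_field_derivative_def)
  from mvt_very_simple[OF assms(3) this] show thesis
    using that by auto
qed

text \<open>Monotonicity makes the difference quotients nonnegative, and
  \<open>deriv_product\<close> excludes the value 0.\<close>

lemma df_pos:
  assumes x: "x \<in> {0..1}"
  shows "df x > 0"
proof -
  have "df x \<ge> 0"
  proof (rule tendsto_lowerbound[OF _ _ at_within_unit_interval_neq_bot[OF x]])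
    show "((\<lambda>y. (f y - f x) / (y - x)) \<longlongrightarrow> df x) (at x within {0..1})"
      using deriv_f[OF x] by (simp add: has_field_derivative_iff)
    have "0 \<le> (f y - f x) / (y - x)" if "y \<in> {0..1}" for y
      using f_le[OF x that] f_le[OF that x] by (cases "x \<le> y") (auto simp: divide_simps)
    then show "\<forall>\<^sub>F y in at x within {0..1}. 0 \<le> (f y - f x) / (y - x)"
      by (simp add: eventually_at_filter)
  qed
  moreover have "df x \<noteq> 0"
    using deriv_product[OF x] by auto
  ultimately show ?thesis by simp
qed

lemma expand_ge:
  assumes "x \<in> {0..1}" "y \<in> {0..1}" "x \<le> y" "\<And>z. x \<le> z \<Longrightarrow> z \<le> y \<Longrightarrow> L \<le> df z"
  shows "L * (y - x) \<le> f y - f x"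
  using mvt[OF assms(1-3)] assms(3,4) by (metis diff_ge_0_iff_ge mult_right_mono)

lemma expand_le:
  assumes "x \<in> {0..1}" "y \<in> {0..1}" "x \<le> y" "\<And>z. x \<le> z \<Longrightarrow> z \<le> y \<Longrightarrow> df z \<le> L"
  shows "f y - f x \<le> L * (y - x)"
  using mvt[OF assms(1-3)] assms(3,4) by (metis diff_ge_0_iff_ge mult_right_mono)

text \<open>The mean value theorem is applied at each step. Since \<open>U\<close> is an interval,
  it contains all points between the two orbits as soon as it contains the orbits.\<close>

lemma funpow_expand_ge:
  assumes U: "is_interval U" "U \<subseteq> {0..1}" "\<And>z. z \<in> U \<Longrightarrow> L \<le> df z" and "L \<ge> 0"
    and "x \<le> y" "\<And>i. i < k \<Longrightarrow> (f ^^ i) x \<in> U" "\<And>i. i < k \<Longrightarrow> (f ^^ i) y \<in> U"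
  shows "L ^ k * (y - x) \<le> (f ^^ k) y - (f ^^ k) x \<and> (f ^^ k) x \<le> (f ^^ k) y"
  using assms(6,7)
proof (induction k)
  case 0
  then show ?case using \<open>x \<le> y\<close> by simp
next
  case (Suc k)
  let ?x = "(f ^^ k) x" and ?y = "(f ^^ k) y"
  have mem: "?x \<in> U" "?y \<in> U" using Suc.prems[of k] by simp_all
  have IH: "L ^ k * (y - x) \<le> ?y - ?x" "?x \<le> ?y"
    using Suc by simp_all
  have "L ^ Suc k * (y - x) \<le> L * (?y - ?x)"
    using mult_left_mono[OF IH(1) \<open>L \<ge> 0\<close>] by (simp add: mult.assoc)
  also have "\<dots> \<le> f ?y - f ?x"
    using mem U IH(2) by (intro expand_ge) (auto intro: mem_is_interval_1_I)
  finally show ?case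
    using f_le[OF subsetD[OF U(2) mem(1)] subsetD[OF U(2) mem(2)] IH(2)] by simp
qed

text \<open>The mean value theorem is applied between \<open>q\<close> and each orbit point, which
  may lie on either side of \<open>q\<close>.\<close>

lemma funpow_contract:
  assumes U: "is_interval U" "U \<subseteq> {0..1}" "\<And>z. z \<in> U \<Longrightarrow> df z \<le> L" and "L \<ge> 0"
    and q: "q \<in> U" "f q = q" and x: "\<And>i. (f ^^ i) x \<in> U"
  shows "\<bar>(f ^^ k) x - q\<bar> \<le> L ^ k * \<bar>x - q\<bar>"
proof (induction k)
  case (Suc k)
  let ?y = "(f ^^ k) x"
  have mem: "?y \<in> {0..1}" "q \<in> {0..1}" using U(2) x q(1) by blast+
  have "\<bar>f ?y - f q\<bar> \<le> L * \<bar>?y - q\<bar>"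
  proof (cases "?y \<le> q")
    case True
    have "f q - f ?y \<le> L * (q - ?y)"
      using mem True U x q by (intro expand_le) (auto intro: mem_is_interval_1_I)
    then show ?thesis using True f_le[OF mem True] by simp
  next
    case False
    then have le: "q \<le> ?y" by simp
    have "f ?y - f q \<le> L * (?y - q)"
      using mem le U x q by (intro expand_le) (auto intro: mem_is_interval_1_I)
    then show ?thesis using le f_le[OF mem(2,1) le] by simp
  qed
  also have "\<dots> \<le> L * (L ^ k * \<bar>x - q\<bar>)"
    by (rule mult_left_mono[OF Suc \<open>L \<ge> 0\<close>])
  finally show ?case using q(2) by (simp add: mult.assoc)
qed simp

lemma funpow_tendsto_fixed:
  assumes "X \<longlonglongrightarrow> q" "\<And>i. X i \<in> {0..1}" "q \<in> {0..1}" "f q = q"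
  shows "(\<lambda>i. (f ^^ k) (X i)) \<longlonglongrightarrow> q"
proof (induction k)
  case (Suc k)
  show ?case
    using continuous_on_tendsto_compose[OF cont_f Suc assms(3)] funpow_mem[OF assms(2)] assms(4)
    by simp
qed (use assms(1) in simp)

lemma funpow_incseq:
  assumes x: "x \<in> {0..1}" "x \<le> f x"
  shows "incseq (\<lambda>k. (f ^^ k) x)"
  using funpow_le[OF x(1) f_mem[OF x(1)] x(2)] by (intro incseq_SucI) (simp add: funpow_swap1)

lemma funpow_decseq:
  assumes x: "x \<in> {0..1}" "f x \<le> x"
  shows "decseq (\<lambda>k. (f ^^ k) x)"
  using funpow_le[OF f_mem[OF x(1)] x(1) x(2)] by (intro decseq_SucI) (simp add: funpow_swap1)

text \<open>Orbits of an increasing map are monotone and here bounded; continuity makes the limit a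
  fixed point.\<close>

lemma funpow_limit:
  assumes x: "x \<in> {0..1}"
  obtains q where "q \<in> {0..1}" "(\<lambda>k. (f ^^ k) x) \<longlonglongrightarrow> q" "f q = q"
proof -
  let ?X = "\<lambda>k. (f ^^ k) x"
  have "monoseq ?X"
    using funpow_incseq[OF x] funpow_decseq[OF x] by (cases "x \<le> f x") (auto simp: monoseq_iff)
  moreover have "norm (?X k) \<le> 1" for k
    using funpow_mem[OF x, of k] by auto
  then have "Bseq ?X" by (rule BseqI')
  ultimately obtain q where q: "?X \<longlonglongrightarrow> q"
    using Bseq_monoseq_convergent by (auto simp: convergent_def)
  have mem: "q \<in> {0..1}"
    by (rule closed_sequentially[OF _ _ q]) (use funpow_mem[OF x] in auto)
  have "(\<lambda>k. f (?X k)) \<longlonglongrightarrow> f q"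
    using continuous_on_tendsto_compose[OF cont_f q mem] funpow_mem[OF x] by simp
  then have "(\<lambda>k. ?X (Suc k)) \<longlonglongrightarrow> f q" by simp
  then have "f q = q"
    using LIMSEQ_unique[OF LIMSEQ_Suc[OF q]] by metis
  then show thesis using that q mem by blast
qed

lemma funpow_deriv_fixed:
  assumes p: "p \<in> {0..1}" "f p = p"
  shows "((f ^^ k) has_real_derivative df p ^ k) (at p within {0..1})"
proof (induction k)
  case 0
  show ?case using DERIV_ident by (simp add: id_def)
next
  case (Suc k)
  have "((\<lambda>x. f ((f ^^ k) x)) has_real_derivative df p * df p ^ k) (at p within {0..1})"
    using p funpow_fixed[OF p(2)] funpow_mem deriv_f
    by (intro has_real_derivative_compose_within Suc) auto
  then show ?case by (simp add: o_def)
qed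

end

text \<open>Differentiate the relation at \<open>p\<close> by the chain rule and cancel
  \<open>dh p > 0\<close>. It serves for \<open>b\<close> acting on \<open>c\<close> and for
  \<open>a\<close> acting on \<open>b\<close>.\<close>

lemma deriv_conjugate_power:
  assumes h: "C1_diffeo h hi dh dhi" and f: "C1_diffeo f fi df dfi"
    and rel: "\<And>x. x \<in> {0..1} \<Longrightarrow> h (f x) = (f ^^ k) (h x)"
    and p: "p \<in> {0..1}" "f p = p" "f (h p) = h p"
  shows "df p = df (h p) ^ k"
proof -
  interpret h: C1_diffeo h hi dh dhi by fact
  interpret f: C1_diffeo f fi df dfi by fact
  have "((\<lambda>x. h (f x)) has_real_derivative dh p * df p) (at p within {0..1})"
    using h.deriv_f[OF p(1)] f.deriv_f[OF p(1)]
    by (intro has_real_derivative_compose_within f.f_image) (simp_all only: p(2))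
  moreover have "((\<lambda>x. (f ^^ k) (h x)) has_real_derivative df (h p) ^ k * dh p) (at p within {0..1})"
    by (intro has_real_derivative_compose_within f.funpow_deriv_fixed h.deriv_f h.f_image h.f_mem p)
  then have "((\<lambda>x. h (f x)) has_real_derivative df (h p) ^ k * dh p) (at p within {0..1})"
    by (rule has_field_derivative_transform_within[OF _ zero_less_one p(1)]) (simp add: rel)
  ultimately have "dh p * df p = df (h p) ^ k * dh p"
    using has_real_derivative_unique_unit_interval p(1) by blast
  then show ?thesis
    using h.df_pos[OF p(1)] by simp
qed

section \<open>Pairs satisfying the Baumslag-Solitar relation b c b^-1 = c^m\<close>

locale C1_affine_pair = b: C1_diffeo b bi db dbi + c: C1_diffeo c ci dc dci
  for b bi db dbi c ci dc dci :: "real \<Rightarrow> real" +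
  fixes m :: nat
  assumes m: "m > 1"
    and rel: "x \<in> {0..1} \<Longrightarrow> b (c x) = (c ^^ m) (b x)"
begin

lemma rel_funpow: "x \<in> {0..1} \<Longrightarrow> b ((c ^^ j) x) = (c ^^ (m * j)) (b x)"
proof (induction j)
  case (Suc j)
  have "b ((c ^^ Suc j) x) = (c ^^ m) (b ((c ^^ j) x))"
    using rel[OF c.funpow_mem[OF Suc.prems]] by simp
  then show ?case
    using Suc by (simp add: funpow_add)
qed simp

lemma rel_inverse: "x \<in> {0..1} \<Longrightarrow> bi ((c ^^ (m * j)) x) = (c ^^ j) (bi x)"
  using rel_funpow[OF b.g_mem] b.f_g b.g_f[OF c.funpow_mem[OF b.g_mem]] by metis

lemma rel_funpow_funpow: "x \<in> {0..1} \<Longrightarrow> (b ^^ k) ((c ^^ j) x) = (c ^^ (m ^ k * j)) ((b ^^ k) x)"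
proof (induction k)
  case (Suc k)
  then show ?case
    using rel_funpow[OF b.funpow_mem[OF Suc.prems]] by (simp add: mult.assoc)
qed simp

lemma rel_inverse_funpow:
  "x \<in> {0..1} \<Longrightarrow> (bi ^^ k) ((c ^^ (m ^ k * j)) x) = (c ^^ j) ((bi ^^ k) x)"
proof (induction k arbitrary: j)
  case (Suc k)
  have "(bi ^^ Suc k) ((c ^^ (m ^ Suc k * j)) x) = bi ((bi ^^ k) ((c ^^ (m ^ k * (m * j))) x))"
    by (simp add: ac_simps)
  then show ?case
    using Suc rel_inverse[OF C1_diffeo.funpow_mem[OF b.inverse Suc.prems]] by simp
qed simp

text \<open>Conjugation by \<open>b\<close> turns the derivative of \<open>c\<close> at
  \<open>q\<close> into its \<open>m\<close>-th power, and 1 is the only positive number equal to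
  its \<open>m\<close>-th power.\<close>

lemma dc_fixed:
  assumes "q \<in> {0..1}" "b q = q" "c q = q"
  shows "dc q = 1"
proof -
  have "dc q = dc q ^ m"
    using deriv_conjugate_power[OF b.C1_diffeo_axioms c.C1_diffeo_axioms rel assms(1,3)] assms(2,3)
    by simp
  then have "dc q ^ 1 = dc q ^ m" by simp
  then show ?thesis
    using m c.df_pos[OF assms(1)] power_inject_exp[of "dc q" 1 m]
      power_strict_increasing_iff[of "dc q" 1 m] power_strict_decreasing[of 1 m "dc q"]
    by (cases "dc q" "1::real" rule: linorder_cases) auto
qed

text \<open>The relation survives inverting \<open>c\<close>; this reduces points moved to the left
  by \<open>c\<close> to points moved to the right.\<close>

lemma inverse_pair: "C1_affine_pair b bi db dbi ci c dci dc m"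
proof (intro C1_affine_pair.intro C1_affine_pair_axioms.intro)
  fix x :: real assume x: "x \<in> {0..1}"
  have "b x = b (c (ci x))" using c.f_g[OF x] by simp
  also have "\<dots> = (c ^^ m) (b (ci x))" by (rule rel[OF c.g_mem[OF x]])
  finally show "b (ci x) = (ci ^^ m) (b x)"
    using c.funpow_inverse[OF b.f_mem[OF c.g_mem[OF x]]] by simp
qed (fact b.C1_diffeo_axioms c.inverse m)+

section \<open>Lengths of the intervals b^-k c^j [z, c z]\<close>

text \<open>Writing \<open>j < m ^ k\<close> in base \<open>m\<close> with digits \<open>d\<close> factors \<open>b\<^sup>-\<^sup>k c\<^sup>j\<close> into \<open>k\<close> steps \<open>b\<^sup>-\<^sup>1 c\<^sup>d\<close>, so
  that only \<open>O(k)\<close> factors contribute to the distortion.\<close>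

lemma digits_expand_ge:
  assumes U: "is_interval U" "U \<subseteq> {0..1}"
    and dcU: "\<And>z. z \<in> U \<Longrightarrow> s \<le> dc z" and dbiU: "\<And>z. z \<in> U \<Longrightarrow> L * s \<le> dbi z"
    and s: "0 \<le> s" "s \<le> 1" and L: "0 \<le> L"
    and S: "\<And>l z d. z \<in> S (Suc l) \<Longrightarrow> d < m \<Longrightarrow> (c ^^ d) z \<in> U \<and> bi ((c ^^ d) z) \<in> S l"
    and "z \<in> S k" "z' \<in> S k" "z \<le> z'" "j < m ^ k"
  shows "(L * s ^ m) ^ k * (z' - z) \<le> (bi ^^ k) ((c ^^ j) z') - (bi ^^ k) ((c ^^ j) z)"
  using assms(9-)
proof (induction k arbitrary: z z' j)
  case 0
  then show ?case by simp
next
  case (Suc k)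
  interpret bi: C1_diffeo bi b dbi db by (rule b.inverse)
  \<comment> \<open>The lowest digit is split off: c^j = c^(m (j div m)) c^d, and b^-1 c^(m i) = c^i
    b^-1.\<close>
  define d where "d = j mod m"
  define y where "y = bi ((c ^^ d) z)"
  define y' where "y' = bi ((c ^^ d) z')"
  have d: "d < m" using m by (simp add: d_def)
  have j: "j = m * (j div m) + d" by (simp add: d_def)
  have jk: "j div m < m ^ k"
    using Suc.prems(4) m by (simp add: less_mult_imp_div_less mult.commute)
  have zU: "(c ^^ i) z \<in> U" "(c ^^ i) z' \<in> U" if "i < m" for i
    using S that Suc.prems by blast+
  have memU: "(c ^^ d) z \<in> U" "(c ^^ d) z' \<in> U"
    using zU d by blast+
  have cd: "s ^ d * (z' - z) \<le> (c ^^ d) z' - (c ^^ d) z \<and> (c ^^ d) z \<le> (c ^^ d) z'"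
    by (rule c.funpow_expand_ge[OF U dcU s(1) Suc.prems(3)]) (use zU d in auto)
  have mem: "(c ^^ d) z \<in> {0..1}" "(c ^^ d) z' \<in> {0..1}"
    using memU U(2) by blast+
  \<comment> \<open>The step b^-1 c^d loses \<open>d\<close> factors \<open>s\<close> from c^d and
    one from b^-1; as d + 1 \<le> m and s \<le> 1, the loss is at most s^m.\<close>
  have "L * s ^ m * (z' - z) \<le> L * (s * s ^ d) * (z' - z)"
    using d s L Suc.prems(3) power_decreasing[of "Suc d" m s]
    by (intro mult_right_mono mult_left_mono) auto
  also have "\<dots> \<le> L * s * ((c ^^ d) z' - (c ^^ d) z)"
    using mult_left_mono[of "s ^ d * (z' - z)" "(c ^^ d) z' - (c ^^ d) z" "L * s"] cd s L
    by (simp add: mult.assoc)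
  also have "\<dots> \<le> y' - y"
    unfolding y_def y'_def using cd memU U(1) mem
    by (intro bi.expand_ge dbiU) (auto intro: mem_is_interval_1_I simp del: atLeastAtMost_iff)
  finally have step: "L * s ^ m * (z' - z) \<le> y' - y" .
  have yle: "y \<le> y'"
    unfolding y_def y'_def using bi.f_le[OF mem] cd by blast
  have yS: "y \<in> S k" "y' \<in> S k"
    unfolding y_def y'_def using S Suc.prems(1,2) d by blast+
  have shift: "(bi ^^ Suc k) ((c ^^ j) w) = (bi ^^ k) ((c ^^ (j div m)) (bi ((c ^^ d) w)))"
    if "(c ^^ d) w \<in> {0..1}" for w
  proof -
    have "(c ^^ j) w = (c ^^ (m * (j div m))) ((c ^^ d) w)"
      by (subst j) (simp add: funpow_add)
    then show ?thesis
      using rel_inverse[OF that] by (simp add: funpow_swap1)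
  qed
  have "(L * s ^ m) ^ Suc k * (z' - z) \<le> (L * s ^ m) ^ k * (y' - y)"
    using mult_left_mono[OF step, of "(L * s ^ m) ^ k"] s L by (simp add: ac_simps)
  also have "\<dots> \<le> (bi ^^ k) ((c ^^ (j div m)) y') - (bi ^^ k) ((c ^^ (j div m)) y)"
    by (rule Suc.IH[OF yS yle jk])
  finally show ?case
    using mem by (simp only: shift y_def y'_def)
qed

text \<open>The intervals for consecutive \<open>j\<close> abut, so their lengths telescope to the
  distance from b^-k z to b^-k c^(m^k) z = c b^-k z. The sets \<open>S l\<close> depend on the
  number \<open>l\<close> of remaining steps, so that the range of starting points may shrink as
  \<open>k\<close> grows.\<close>

lemma tiling_length_ge:
  assumes U: "is_interval U" "U \<subseteq> {0..1}"
    and dcU: "\<And>z. z \<in> U \<Longrightarrow> s \<le> dc z" and dbiU: "\<And>z. z \<in> U \<Longrightarrow> L * s \<le> dbi z"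
    and s: "0 \<le> s" "s \<le> 1" and L: "0 \<le> L"
    and S: "\<And>l z d. z \<in> S (Suc l) \<Longrightarrow> d < m \<Longrightarrow> (c ^^ d) z \<in> U \<and> bi ((c ^^ d) z) \<in> S l"
    and z: "z \<in> S k" "c z \<in> S k" "z \<le> c z" "z \<in> {0..1}"
  shows "(real m * (L * s ^ m)) ^ k * (c z - z) \<le> c ((bi ^^ k) z) - (bi ^^ k) z"
proof -
  let ?t = "\<lambda>j. (bi ^^ k) ((c ^^ j) z)"
  have "(real m * (L * s ^ m)) ^ k * (c z - z) = (\<Sum>j<m ^ k. (L * s ^ m) ^ k * (c z - z))"
    by (simp add: power_mult_distrib)
  also have "\<dots> \<le> (\<Sum>j<m ^ k. ?t (Suc j) - ?t j)"
  proof (rule sum_mono)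
    fix j assume "j \<in> {..<m ^ k}"
    then show "(L * s ^ m) ^ k * (c z - z) \<le> ?t (Suc j) - ?t j"
      using digits_expand_ge[where S = S, OF U dcU dbiU s L S z(1-3), of j] by (simp add: funpow_swap1)
  qed
  also have "\<dots> = ?t (m ^ k) - ?t 0"
    by (rule sum_lessThan_telescope)
  also have "\<dots> = c ((bi ^^ k) z) - (bi ^^ k) z"
    using rel_inverse_funpow[OF z(4), of k 1] by simp
  finally show ?thesis .
qed

section \<open>Common fixed points of b and c as limits\<close>

lemma local_bounds:
  assumes q: "q \<in> {0..1}" "b q = q" "c q = q" and s: "0 < s" "s < 1"
  obtains \<delta> where "\<delta> > 0"
    "\<And>y. y \<in> {0..1} \<Longrightarrow> \<bar>y - q\<bar> < \<delta> \<Longrightarrow>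
      s < dc y \<and> dc y < 1 / s \<and> dbi q * s < dbi y \<and> dbi y < dbi q / s \<and> s / dbi q < db y"
proof -
  interpret bi: C1_diffeo bi b dbi db by (rule b.inverse)
  have pos: "dbi q > 0" by (rule bi.df_pos[OF q(1)])
  have "db q = 1 / dbi q"
    using b.deriv_product[OF q(1)] q(2) pos by (simp add: field_simps)
  \<comment> \<open>Each bound is strict at \<open>q\<close> because s < 1, hence persists nearby.
    Upper bounds are negated to fit \<open>continuous_on_eventually_less\<close>.\<close>
  then have at: "s < dc q" "- (1 / s) < - dc q" "dbi q * s < dbi q" "- (dbi q / s) < - dbi q"
      "s / dbi q < db q"
    using s pos dc_fixed[OF q] by (simp_all add: field_simps)
  obtain d1 where d1: "d1 > 0" "\<And>y. y \<in> {0..1} \<Longrightarrow> \<bar>y - q\<bar> < d1 \<Longrightarrow> s < dc y"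
    using continuous_on_eventually_less[OF c.cont_df q(1) at(1)] by metis
  obtain d2 where d2: "d2 > 0" "\<And>y. y \<in> {0..1} \<Longrightarrow> \<bar>y - q\<bar> < d2 \<Longrightarrow> - (1 / s) < - dc y"
    using continuous_on_eventually_less[OF continuous_on_minus[OF c.cont_df] q(1) at(2)] by metis
  obtain d3 where d3: "d3 > 0" "\<And>y. y \<in> {0..1} \<Longrightarrow> \<bar>y - q\<bar> < d3 \<Longrightarrow> dbi q * s < dbi y"
    using continuous_on_eventually_less[OF bi.cont_df q(1) at(3)] by metis
  obtain d4 where d4: "d4 > 0" "\<And>y. y \<in> {0..1} \<Longrightarrow> \<bar>y - q\<bar> < d4 \<Longrightarrow> - (dbi q / s) < - dbi y"
    using continuous_on_eventually_less[OF continuous_on_minus[OF bi.cont_df] q(1) at(4)] by metis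
  obtain d5 where d5: "d5 > 0" "\<And>y. y \<in> {0..1} \<Longrightarrow> \<bar>y - q\<bar> < d5 \<Longrightarrow> s / dbi q < db y"
    using continuous_on_eventually_less[OF b.cont_df q(1) at(5)] by metis
  show thesis
  proof (rule that[of "Min {d1, d2, d3, d4, d5}"])
    show "Min {d1, d2, d3, d4, d5} > 0"
      using d1(1) d2(1) d3(1) d4(1) d5(1) by simp
    fix y assume "y \<in> {0..1}" "\<bar>y - q\<bar> < Min {d1, d2, d3, d4, d5}"
    then show "s < dc y \<and> dc y < 1 / s \<and> dbi q * s < dbi y \<and> dbi y < dbi q / s \<and> s / dbi q < db y"
      using d1(2)[of y] d2(2)[of y] d3(2)[of y] d4(2)[of y] d5(2)[of y] by simp
  qed
qed

text \<open>With s^(m+2) = 2/3 the product is 2m/3, at least 4/3. The exponent provides for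
  \<open>m\<close> factors \<open>s\<close> lost per step in the tiling estimate and up to two in
  the estimates it is compared with.\<close>

lemma distortion_factor:
  obtains s :: real where "0 < s" "s < 1" "1 < real m * (s ^ m * s * s)"
proof
  let ?s = "root (Suc (Suc m)) (2/3)"
  show "0 < ?s" "?s < 1" by simp_all
  have "?s ^ m * ?s * ?s = ?s ^ Suc (Suc m)" by (simp only: power_Suc2)
  also have "\<dots> = 2/3"
    by (rule real_root_pow_pos2) simp_all
  finally have eq: "?s ^ m * ?s * ?s = 2/3" .
  show "1 < real m * (?s ^ m * ?s * ?s)"
    unfolding eq using m by simp
qed

text \<open>Otherwise \<open>c'(q) = 1\<close>, and the \<open>m\<^sup>k\<close> disjoint intervals \<open>b\<^sup>-\<^sup>k c\<^sup>j [x, c x]\<close> have total length about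
  \<open>m\<^sup>k\<close> times \<open>(b\<^sup>-\<^sup>1)'(q)\<^sup>k\<close>, while they lie between \<open>b\<^sup>-\<^sup>k x\<close> and \<open>c (b\<^sup>-\<^sup>k x)\<close>.\<close>

lemma limit_moved:
  assumes x: "x \<in> {0..1}" "x < c x" and q: "q \<in> {0..1}" "bi q = q"
    and lim: "(\<lambda>k. (bi ^^ k) x) \<longlonglongrightarrow> q"
  shows "c q \<noteq> q"
proof
  assume cq: "c q = q"
  interpret bi: C1_diffeo bi b dbi db by (rule b.inverse)
  have bq: "b q = q" using b.f_g[OF q(1)] q(2) by simp
  obtain s where s: "0 < s" "s < 1" "1 < real m * (s ^ m * s * s)"
    by (rule distortion_factor)
  have "real m * (s ^ m * s * s) \<le> real m * (s ^ m * s)"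
    using s mult_left_mono[of s 1 "s ^ m * s"] by (intro mult_left_mono) simp_all
  with s(3) have ms: "1 < real m * (s ^ m * s)" by simp
  obtain \<delta> where \<delta>: "\<delta> > 0" and bd: "\<And>y. y \<in> {0..1} \<Longrightarrow> \<bar>y - q\<bar> < \<delta> \<Longrightarrow>
      s < dc y \<and> dc y < 1 / s \<and> dbi q * s < dbi y \<and> dbi y < dbi q / s \<and> s / dbi q < db y"
    using local_bounds[OF q(1) bq cq s(1,2)] by metis
  \<comment> \<open>The point \<open>x\<close> is replaced by a late orbit point y = b^-K x such
    that both \<open>y\<close> and c^m y lie within \<delta> of \<open>q\<close>, where the
    derivative bounds hold.\<close>
  have "(\<lambda>k. (c ^^ m) ((bi ^^ k) x)) \<longlonglongrightarrow> q"
    by (rule c.funpow_tendsto_fixed[OF lim bi.funpow_mem[OF x(1)] q(1) cq])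
  then have "\<forall>\<^sub>F k in sequentially. \<bar>(c ^^ m) ((bi ^^ k) x) - q\<bar> < \<delta>"
    using \<delta> by (simp only: tendsto_iff dist_real_def)
  moreover have "\<forall>\<^sub>F k in sequentially. \<bar>(bi ^^ k) x - q\<bar> < \<delta>"
    using tendstoD[OF lim \<delta>] by (simp add: dist_real_def)
  ultimately have "\<forall>\<^sub>F k in sequentially. \<bar>(c ^^ m) ((bi ^^ k) x) - q\<bar> < \<delta> \<and> \<bar>(bi ^^ k) x - q\<bar> < \<delta>"
    by (rule eventually_conj)
  then obtain K where K: "\<bar>(c ^^ m) ((bi ^^ K) x) - q\<bar> < \<delta>" "\<bar>(bi ^^ K) x - q\<bar> < \<delta>"
    using eventually_happens'[OF sequentially_bot] by blast
  define y where "y = (bi ^^ K) x"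
  have y: "y \<in> {0..1}" unfolding y_def by (rule bi.funpow_mem[OF x(1)])
  have cy: "c y \<in> {0..1}" and cmy: "(c ^^ m) y \<in> {0..1}"
    using c.f_mem c.funpow_mem y by blast+
  \<comment> \<open>Otherwise applying b^K, which conjugates \<open>c\<close> to c^(m^K), would give
    c^(m^K) x \<le> x.\<close>
  have "y < c y"
  proof (rule ccontr)
    assume "\<not> y < c y"
    then have "(b ^^ K) (c y) \<le> (b ^^ K) y"
      by (intro b.funpow_le cy y) simp
    also have "\<dots> = x"
      unfolding y_def by (rule bi.funpow_inverse[OF x(1)])
    also have "(b ^^ K) (c y) = (c ^^ (m ^ K)) x"
      using rel_funpow_funpow[OF y, of K 1] bi.funpow_inverse[OF x(1)] by (simp add: y_def)
    finally have "(c ^^ (m ^ K)) x \<le> x" .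
    moreover have "(c ^^ 1) x \<le> (c ^^ (m ^ K)) x"
      by (rule incseqD[OF c.funpow_incseq[OF x(1) less_imp_le[OF x(2)]]]) (use m in simp)
    ultimately show False using x(2) by simp
  qed
  have incy: "incseq (\<lambda>k. (c ^^ k) y)"
    by (rule c.funpow_incseq[OF y less_imp_le[OF \<open>y < c y\<close>]])
  have limy: "(\<lambda>k. (bi ^^ k) y) \<longlonglongrightarrow> q"
    using LIMSEQ_ignore_initial_segment[OF lim, of K] by (simp add: y_def funpow_add)
  have near: "s < dc z" "dc z < 1 / s" "dbi q * s < dbi z" "dbi z < dbi q / s"
    if "z \<in> {min q y..max q ((c ^^ m) y)}" for z
  proof -
    have "\<bar>z - q\<bar> < \<delta>" "z \<in> {0..1}"
      using that K y cmy q(1) by (auto simp flip: y_def simp: abs_if split: if_splits)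
    then show "s < dc z" "dc z < 1 / s" "dbi q * s < dbi z" "dbi z < dbi q / s"
      using bd by blast+
  qed
  have cd_fixed: "(c ^^ d) q = q" for d
    by (rule c.funpow_fixed[OF cq])
  have lam: "dbi q > 0" by (rule bi.df_pos[OF q(1)])
  have cdy: "y \<le> (c ^^ d) y" "(c ^^ d) (c y) \<le> (c ^^ m) y" if "d < m" for d
    using incseqD[OF incy, of 0 d] incseqD[OF incy, of "Suc d" m] that
    by (simp_all add: funpow_swap1)
  have bicm: "bi ((c ^^ m) y) = c (bi y)"
    using rel_inverse[OF y, of 1] by simp
  \<comment> \<open>The gap between b^-k y and its image under \<open>c\<close> is bounded by a
    multiple of the distance from b^-k y to \<open>q\<close>, and that distance by (dbi q / s)^k |y
    - q|.\<close>
  let ?G = "\<lambda>k. (real m * (dbi q * s ^ m)) ^ k * (c y - y) \<le> (1 / s) * \<bar>(bi ^^ k) y - q\<bar>"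
  have "?G k \<and> \<bar>(bi ^^ k) y - q\<bar> \<le> (dbi q / s) ^ k * \<bar>y - q\<bar>" for k
  proof (cases "bi y \<le> y")
    case True
    then have dec: "decseq (\<lambda>k. (bi ^^ k) y)"
      by (rule bi.funpow_decseq[OF y])
    have qle: "q \<le> (bi ^^ k) y" for k
      by (rule decseq_ge[OF dec limy])
    have ley: "(bi ^^ k) y \<le> y" for k
      using decseqD[OF dec, of 0 k] by simp
    have qy: "q \<le> y" using qle[of 0] by simp
    have ycm: "y \<le> (c ^^ m) y" "c y \<le> (c ^^ m) y"
      using incseqD[OF incy, of 0 m] incseqD[OF incy, of 1 m] m by simp_all
    define U where "U = {q..(c ^^ m) y}"
    have U: "is_interval U" "U \<subseteq> {0..1}"
      using q(1) cmy by (auto simp: U_def is_interval_cc)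
    have nearU: "s \<le> dc z" "dc z \<le> 1 / s" "dbi q * s \<le> dbi z" "dbi z \<le> dbi q / s" if "z \<in> U" for z
      using near[of z] that qy ycm by (auto simp: U_def)
    \<comment> \<open>The power c^d maps [q, c y] into [q, c^m y], and b^-1 brings c^m y back to c
      (b^-1 y) \<le> c y.\<close>
    have S: "(c ^^ d) z \<in> U \<and> bi ((c ^^ d) z) \<in> {q..c y}" if z: "z \<in> {q..c y}" and d: "d < m" for z d
    proof -
      have z1: "z \<in> {0..1}" using z q(1) cy by auto
      have lo: "q \<le> (c ^^ d) z"
        using c.funpow_le[OF q(1) z1, of d] z cd_fixed by simp
      have hi: "(c ^^ d) z \<le> (c ^^ m) y"
        using c.funpow_le[OF z1 cy, of d] z cdy(2)[OF d] by simp
      have "q \<le> bi ((c ^^ d) z)"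
        using bi.f_le[OF q(1) c.funpow_mem[OF z1] lo] q(2) by simp
      moreover have "bi ((c ^^ d) z) \<le> c y"
        using bi.f_le[OF c.funpow_mem[OF z1] cmy hi] c.f_le[OF bi.f_mem[OF y] y True]
        by (simp add: bicm)
      ultimately show ?thesis using lo hi by (simp add: U_def)
    qed
    have "(real m * (dbi q * s ^ m)) ^ k * (c y - y) \<le> c ((bi ^^ k) y) - (bi ^^ k) y"
      by (rule tiling_length_ge[where S = "\<lambda>_. {q..c y}", OF U nearU(1,3)])
        (use s lam S y qy \<open>y < c y\<close> in auto)
    also have "\<dots> \<le> c ((bi ^^ k) y) - c q"
      using qle[of k] cq by simp
    also have "\<dots> \<le> (1 / s) * ((bi ^^ k) y - q)"
      using order_trans[OF ley[of k] ycm(1)] qle[of k] q(1) bi.funpow_mem[OF y]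
      by (intro c.expand_le nearU(2)) (auto simp: U_def)
    finally have "?G k" using qle[of k] by simp
    moreover have "\<bar>(bi ^^ k) y - q\<bar> \<le> (dbi q / s) ^ k * \<bar>y - q\<bar>"
      by (rule bi.funpow_contract[OF U nearU(4)])
        (use s lam q(2) qle order_trans[OF ley ycm(1)] qy ycm in \<open>auto simp: U_def\<close>)
    ultimately show ?thesis by blast
  next
    case False
    then have inc: "incseq (\<lambda>k. (bi ^^ k) y)"
      by (intro bi.funpow_incseq y) simp
    have leq: "(bi ^^ k) y \<le> q" for k
      by (rule incseq_le[OF inc limy])
    have yle: "y \<le> (bi ^^ k) y" for k
      using incseqD[OF inc, of 0 k] by simp
    have yq: "y \<le> q" using leq[of 0] by simp
    have cyq: "c y \<le> q"
      using c.f_le[OF y q(1) yq] cq by simp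
    define U where "U = {y..q}"
    have U: "is_interval U" "U \<subseteq> {0..1}"
      using q(1) y by (auto simp: U_def is_interval_cc)
    have nearU: "s \<le> dc z" "dc z \<le> 1 / s" "dbi q * s \<le> dbi z" "dbi z \<le> dbi q / s" if "z \<in> U" for z
      using near[of z] that yq by (auto simp: U_def le_max_iff_disj)
    \<comment> \<open>To the left of \<open>q\<close>, both \<open>c\<close> and b^-1 move
      \<open>y\<close> to the right and fix \<open>q\<close>, so [y, q] is mapped into
      itself.\<close>
    have S: "(c ^^ d) z \<in> U \<and> bi ((c ^^ d) z) \<in> U" if z: "z \<in> U" and d: "d < m" for z d
    proof -
      have z1: "z \<in> {0..1}" using z U by auto
      have lo: "y \<le> (c ^^ d) z"
        using c.funpow_le[OF y z1, of d] cdy(1)[OF d] z by (simp add: U_def)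
      have hi: "(c ^^ d) z \<le> q"
        using c.funpow_le[OF z1 q(1), of d] z cd_fixed by (simp add: U_def)
      have "bi ((c ^^ d) z) \<le> q"
        using bi.f_le[OF c.funpow_mem[OF z1] q(1) hi] q(2) by simp
      moreover have "y \<le> bi ((c ^^ d) z)"
        using bi.f_le[OF y c.funpow_mem[OF z1] lo] False by simp
      ultimately show ?thesis using lo hi by (simp add: U_def)
    qed
    have "(real m * (dbi q * s ^ m)) ^ k * (c y - y) \<le> c ((bi ^^ k) y) - (bi ^^ k) y"
      by (rule tiling_length_ge[where S = "\<lambda>_. U", OF U nearU(1,3)])
        (use s lam S y yq cyq \<open>y < c y\<close> in \<open>auto simp: U_def\<close>)
    also have "\<dots> \<le> q - (bi ^^ k) y"
      using c.f_le[OF bi.funpow_mem[OF y] q(1) leq[of k]] cq by simp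
    also have "\<dots> \<le> (1 / s) * (q - (bi ^^ k) y)"
      using s leq[of k] mult_right_mono[of 1 "1 / s" "q - (bi ^^ k) y"] by simp
    finally have "?G k" using leq[of k] by simp
    moreover have "\<bar>(bi ^^ k) y - q\<bar> \<le> (dbi q / s) ^ k * \<bar>y - q\<bar>"
      by (rule bi.funpow_contract[OF U nearU(4)])
        (use s lam q(2) leq yle yq in \<open>auto simp: U_def\<close>)
    ultimately show ?thesis by blast
  qed
  note G = this
  have "(real m * (s ^ m * s)) ^ k * (c y - y) \<le> (1 / s) * \<bar>y - q\<bar>" for k
  proof -
    have "(1 / s) * \<bar>(bi ^^ k) y - q\<bar> \<le> (1 / s) * ((dbi q / s) ^ k * \<bar>y - q\<bar>)"
      using G[of k] s by (intro mult_left_mono) auto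
    with G[of k] have "(real m * (dbi q * s ^ m)) ^ k * (c y - y) \<le> (1 / s) * ((dbi q / s) ^ k * \<bar>y - q\<bar>)"
      by linarith
    \<comment> \<open>The unknown rate \<open>dbi q\<close> occurs on both sides and cancels,
      leaving the ratio m s^(m+1) > 1.\<close>
    moreover have "real m * (dbi q * s ^ m) = (dbi q / s) * (real m * (s ^ m * s))"
      using s by simp
    ultimately have "(dbi q / s) ^ k * ((real m * (s ^ m * s)) ^ k * (c y - y)) \<le> (dbi q / s) ^ k * ((1 / s) * \<bar>y - q\<bar>)"
      by (simp only: power_mult_distrib ac_simps)
    then show ?thesis
      by (rule mult_left_le_imp_le) (use lam s in simp)
  qed
  then show False
    using power_times_unbounded ms \<open>y < c y\<close> by (metis diff_gt_0_iff_gt)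
qed

section \<open>Fixed points of b moved by c\<close>

lemma repelled_from_fixed:
  assumes q: "q \<in> {0..1}" "b q = q" "q < z" "z \<in> {0..1}" and s: "0 < s" "s < dbi q" "s < 1"
  obtains e where "e > 0" "\<And>k. s ^ k * e \<le> (bi ^^ k) z - q"
proof -
  interpret bi: C1_diffeo bi b dbi db by (rule b.inverse)
  have biq: "bi q = q" using b.g_f[OF q(1)] q(2) by simp
  obtain \<delta> where \<delta>: "\<delta> > 0" "\<And>y. y \<in> {0..1} \<Longrightarrow> \<bar>y - q\<bar> < \<delta> \<Longrightarrow> s < dbi y"
    using continuous_on_eventually_less[OF bi.cont_df q(1) s(2)] by metis
  define e where "e = min (\<delta> / 2) (z - q)"
  have e: "e > 0" "e \<le> z - q" "e < \<delta>"
    using \<delta>(1) q(3) by (auto simp: e_def min_def)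
  have "s ^ k * e \<le> min e ((bi ^^ k) z - q)" for k
  proof (induction k)
    case (Suc k)
    let ?y = "(bi ^^ k) z"
    \<comment> \<open>Truncating the orbit point at q + e keeps [q, w] where (b^-1)' > s;
      monotonicity of b^-1 carries the bound back to the orbit point.\<close>
    let ?w = "q + min e (?y - q)"
    have y: "?y \<in> {0..1}" by (rule bi.funpow_mem[OF q(4)])
    have "q \<le> ?y"
      using bi.funpow_le[OF q(1,4), of k] q(3) bi.funpow_fixed[OF biq, of k] by simp
    then have w: "q \<le> ?w" "?w \<le> ?y" "?w \<in> {0..1}" "?w - q \<le> e"
      using e q(1) y by auto
    have "s * (?w - q) \<le> bi ?w - bi q"
    proof (rule bi.expand_ge[OF q(1) w(3,1)])
      fix t assume "q \<le> t" "t \<le> ?w"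
      then have "t \<in> {0..1}" "\<bar>t - q\<bar> < \<delta>"
        using w e(3) q(1) by auto
      then show "s \<le> dbi t" using \<delta>(2) by (simp add: less_imp_le)
    qed
    also have "\<dots> \<le> bi ?y - q"
      using bi.f_le[OF w(3) y w(2)] biq by simp
    finally have 1: "s * (?w - q) \<le> bi ?y - q" .
    have "s * (s ^ k * e) \<le> s * (?w - q)"
      using Suc s by (intro mult_left_mono) auto
    moreover have "s * (?w - q) \<le> 1 * (?w - q)"
      using w s by (intro mult_right_mono) auto
    ultimately show ?case
      using 1 w(4) by (simp add: mult.assoc)
  qed (use e in simp)
  then show thesis
    using that[of e] e(1) by simp
qed

text \<open>The points \<open>c\<^sup>i q\<close> increase to a common fixed point \<open>v\<close> of \<open>b\<close> and \<open>c\<close> with \<open>c'(v) = 1\<close>.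
  Near \<open>v\<close> the \<open>m\<^sup>k\<close> intervals into which the conjugate \<open>b\<^sup>-\<^sup>k c b\<^sup>k\<close>, an \<open>m\<^sup>k\<close>-th root of \<open>c\<close>, cuts a
  fundamental domain of \<open>c\<close> are comparable up to a factor \<open>s\<^sup>-\<^sup>k\<close>, where \<open>s < 1\<close> is arbitrarily close
  to \<open>1\<close>; so they are exponentially short. As \<open>b\<^sup>-\<^sup>k c b\<^sup>k\<close> commutes with \<open>c\<close>, a fixed power of \<open>c\<close> carries
  this estimate back to \<open>q\<close>, where it contradicts \<open>b'(q) \<le> 1\<close>.\<close>

lemma fixed_moved_expanding:
  assumes q: "q \<in> {0..1}" "b q = q" "q < c q"
  shows "1 < db q"
proof (rule ccontr)
  assume "\<not> 1 < db q"
  interpret bi: C1_diffeo bi b dbi db by (rule b.inverse)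
  have "dbi q * db q = 1"
    using b.deriv_product[OF q(1)] q(2) by simp
  then have dbiq: "1 \<le> dbi q"
    using \<open>\<not> 1 < db q\<close> b.df_pos[OF q(1)] bi.df_pos[OF q(1)] mult_left_mono[of "db q" 1 "dbi q"]
    by simp
  have biq: "bi q = q" using b.g_f[OF q(1)] q(2) by simp
  obtain s where s: "0 < s" "s < 1" "1 < real m * (s ^ m * s * s)"
    by (rule distortion_factor)
  \<comment> \<open>The points \<open>p i\<close> play the role of the integers in the affine
    action: \<open>b\<close> multiplies the index by \<open>m\<close> and \<open>c\<close> adds 1 to
    it.\<close>
  define p where "p = (\<lambda>i. (c ^^ i) q)"
  have p_mem: "p i \<in> {0..1}" for i
    unfolding p_def by (rule c.funpow_mem[OF q(1)])
  have inc: "incseq p"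
    unfolding p_def by (rule c.funpow_incseq[OF q(1) less_imp_le[OF q(3)]])
  have cp: "(c ^^ d) (p i) = p (i + d)" for i d
    by (simp add: p_def funpow_add add.commute)
  obtain v where v: "v \<in> {0..1}" "p \<longlonglongrightarrow> v" "c v = v"
    using c.funpow_limit[OF q(1)] unfolding p_def by metis
  have pv: "p i \<le> v" for i by (rule incseq_le[OF inc v(2)])
  have bp: "b (p i) = p (m * i)" for i
    using rel_funpow[OF q(1), of i] q(2) by (simp add: p_def)
  have bip: "bi (p (m * i)) = p i" for i
    using rel_inverse[OF q(1), of i] biq by (simp add: p_def)
  \<comment> \<open>The images b (p i) = p (m i) form a subsequence of \<open>p\<close>, so
    continuity makes \<open>v\<close> a fixed point of \<open>b\<close>.\<close>
  have "(\<lambda>i. b (p i)) \<longlonglongrightarrow> b v"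
    using continuous_on_tendsto_compose[OF b.cont_f v(2,1)] p_mem by simp
  moreover have "(\<lambda>i. b (p i)) \<longlonglongrightarrow> v"
    unfolding bp using LIMSEQ_subseq_LIMSEQ[OF v(2), of "\<lambda>i. m * i"] m
    by (simp add: o_def strict_mono_def)
  ultimately have bv: "b v = v" by (rule LIMSEQ_unique)
  then have biv: "bi v = v" using b.g_f[OF v(1)] by simp
  have lam: "dbi v > 0" by (rule bi.df_pos[OF v(1)])
  obtain \<delta> where \<delta>: "\<delta> > 0" and bd: "\<And>y. y \<in> {0..1} \<Longrightarrow> \<bar>y - v\<bar> < \<delta> \<Longrightarrow>
      s < dc y \<and> dc y < 1 / s \<and> dbi v * s < dbi y \<and> dbi y < dbi v / s \<and> s / dbi v < db y"
    using local_bounds[OF v(1) bv v(3) s(1,2)] by metis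
  have "\<forall>\<^sub>F i in sequentially. dist (p i) v < \<delta>"
    by (rule tendstoD[OF v(2) \<delta>])
  then obtain N where N: "\<bar>p N - v\<bar> < \<delta>"
    using eventually_happens'[OF sequentially_bot] unfolding dist_real_def by blast
  define U where "U = {p N..v}"
  have U: "is_interval U" "U \<subseteq> {0..1}"
    using p_mem[of N] v(1) by (auto simp: U_def is_interval_cc)
  have nearU: "s \<le> dc z" "dbi v * s \<le> dbi z" "s / dbi v \<le> db z" if "z \<in> U" for z
  proof -
    have "\<bar>z - v\<bar> < \<delta>" "z \<in> {0..1}"
      using that N U(2) by (auto simp: U_def)
    then show "s \<le> dc z" "dbi v * s \<le> dbi z" "s / dbi v \<le> db z"
      using bd by (auto intro: less_imp_le simp del: atLeastAtMost_iff)
  qed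
  \<comment> \<open>As b^-1 divides the index by \<open>m\<close>, a point to the right of p (m^l N)
    stays in \<open>U\<close> through \<open>l\<close> steps b^-1 c^d.\<close>
  have S: "(c ^^ d) z \<in> U \<and> bi ((c ^^ d) z) \<in> {p (m ^ l * N)..v}"
    if z: "z \<in> {p (m ^ Suc l * N)..v}" and d: "d < m" for z d l
  proof -
    have z1: "z \<in> {0..1}" using z p_mem[of "m ^ Suc l * N"] v(1) by auto
    have "p (m ^ Suc l * N) \<le> p (m ^ Suc l * N + d)"
      by (rule incseqD[OF inc]) simp
    also have "\<dots> \<le> (c ^^ d) z"
      using c.funpow_le[OF p_mem z1, of _ d] z cp by simp
    finally have lo: "p (m ^ Suc l * N) \<le> (c ^^ d) z" .
    have hi: "(c ^^ d) z \<le> v"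
      using c.funpow_le[OF z1 v(1), of d] z c.funpow_fixed[OF v(3), of d] by simp
    have "p N \<le> p (m ^ Suc l * N)"
      by (rule incseqD[OF inc]) (use m in simp)
    moreover have "p (m ^ l * N) \<le> bi ((c ^^ d) z)"
      using bi.f_le[OF p_mem c.funpow_mem[OF z1] lo] bip[of "m ^ l * N"] by (simp add: mult.assoc)
    moreover have "bi ((c ^^ d) z) \<le> v"
      using bi.f_le[OF c.funpow_mem[OF z1] v(1) hi] biv by simp
    ultimately show ?thesis using lo hi by (simp add: U_def)
  qed
  \<comment> \<open>A global lower bound for c' suffices to control c^N, because \<open>N\<close>
    does not depend on \<open>k\<close>.\<close>
  obtain \<mu> where \<mu>: "\<mu> > 0" "\<And>z. z \<in> {0..1} \<Longrightarrow> \<mu> \<le> dc z"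
  proof -
    obtain z0 where "z0 \<in> {0..1}" "\<And>z. z \<in> {0..1} \<Longrightarrow> dc z0 \<le> dc z"
      using continuous_attains_inf[OF compact_Icc _ c.cont_df] by auto
    then show thesis using that[of "dc z0"] c.df_pos by blast
  qed
  \<comment> \<open>This is where the negated claim enters: it gives \<open>dbi q\<close> \<ge> 1 >
    s, so b^-k (c q) cannot approach \<open>q\<close> faster than s^k.\<close>
  obtain e where e: "e > 0" "\<And>k. s ^ k * e \<le> (bi ^^ k) (c q) - q"
    using repelled_from_fixed[OF q(1,2,3) c.f_mem[OF q(1)] s(1) _ s(2)] dbiq s(2) by auto
  have "(real m * (s ^ m * s * s)) ^ k * (\<mu> ^ N * e) \<le> 1" for k
  proof -
    \<comment> \<open>With r = b^-k c b^k, these are y = r q and x = r (p N), since \<open>r\<close>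
      commutes with c^N. Moreover b^k carries [p N, x] to [p M, c (p M)].\<close>
    define y where "y = (bi ^^ k) (c q)"
    define x where "x = (c ^^ N) y"
    define M where "M = m ^ k * N"
    have y: "y \<in> {0..1}"
      unfolding y_def by (rule bi.funpow_mem[OF c.f_mem[OF q(1)]])
    have x: "x \<in> {0..1}"
      unfolding x_def by (rule c.funpow_mem[OF y])
    have qy: "q \<le> y"
      using bi.funpow_le[OF q(1) c.f_mem[OF q(1)] less_imp_le[OF q(3)], of k]
        bi.funpow_fixed[OF biq, of k] by (simp add: y_def)
    have yv: "y \<le> v"
      using bi.funpow_le[OF c.f_mem[OF q(1)] v(1), of k] pv[of 1] bi.funpow_fixed[OF biv, of k]
      by (simp add: y_def p_def)
    have Nx: "p N \<le> x" "x \<le> v"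
      using c.funpow_le[OF q(1) y qy, of N] c.funpow_le[OF y v(1) yv, of N]
        c.funpow_fixed[OF v(3), of N] by (simp_all add: x_def p_def)
    have "s ^ k * (\<mu> ^ N * e) = \<mu> ^ N * (s ^ k * e)" by simp
    also have "\<dots> \<le> \<mu> ^ N * (y - q)"
      using \<mu>(1) e(2)[of k] by (intro mult_left_mono) (simp_all add: y_def)
    also have "\<dots> \<le> x - p N"
      unfolding x_def p_def
      by (rule conjunct1[OF c.funpow_expand_ge[where U = "{0..1}"]])
        (use \<mu> qy c.funpow_mem[OF q(1)] c.funpow_mem[OF y] in
          \<open>simp_all add: is_interval_cc less_imp_le del: atLeastAtMost_iff\<close>)
    finally have 1: "s ^ k * (\<mu> ^ N * e) \<le> x - p N" .
    have bU: "b z \<in> U" if "z \<in> U" for z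
    proof -
      have z: "z \<in> {0..1}" using that U(2) by blast
      have "p N \<le> p (m * N)" by (rule incseqD[OF inc]) (use m in simp)
      then show ?thesis
        using that b.f_le[OF p_mem z, of N] b.f_le[OF z v(1)] bv bp[of N] by (simp add: U_def)
    qed
    have bkU: "(b ^^ i) z \<in> U" if "z \<in> U" for z i
      using that by (induction i) (auto intro: bU)
    have bk: "(b ^^ k) (p N) = p M" "(b ^^ k) x = c (p M)"
    proof -
      show "(b ^^ k) (p N) = p M"
        using rel_funpow_funpow[OF q(1), of k N] b.funpow_fixed[OF q(2), of k]
        by (simp add: p_def M_def)
      have "(b ^^ k) x = (c ^^ M) ((b ^^ k) y)"
        using rel_funpow_funpow[OF y, of k N] by (simp add: x_def M_def)
      also have "\<dots> = (c ^^ M) (c q)"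
        using bi.funpow_inverse[OF c.f_mem[OF q(1)], of k] by (simp add: y_def)
      finally show "(b ^^ k) x = c (p M)"
        by (simp add: p_def funpow_swap1)
    qed
    have "(s / dbi v) ^ k * (x - p N) \<le> (b ^^ k) x - (b ^^ k) (p N)"
      by (rule conjunct1[OF b.funpow_expand_ge[OF U nearU(3)]])
        (use s lam Nx bkU in \<open>auto simp: U_def\<close>)
    then have 2: "(s / dbi v) ^ k * (x - p N) \<le> c (p M) - p M"
      by (simp only: bk)
    have cpM: "c (p M) = p (Suc M)" using cp[of 1 M] by simp
    \<comment> \<open>The m^k tiles with \<open>z\<close> = \<open>p M\<close> fill [p N, c (p N)],
      whose length is at most 1.\<close>
    have "(real m * (dbi v * s ^ m)) ^ k * (c (p M) - p M) \<le> c ((bi ^^ k) (p M)) - (bi ^^ k) (p M)"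
      by (rule tiling_length_ge[where S = "\<lambda>l. {p (m ^ l * N)..v}", OF U nearU(1,2)])
        (use s lam S pv incseqD[OF inc, of M "Suc M"] p_mem cpM in
          \<open>auto simp: M_def simp del: power_Suc\<close>)
    also have "\<dots> \<le> 1"
      using c.f_mem[OF bi.funpow_mem[OF p_mem[of M], of k]] bi.funpow_mem[OF p_mem[of M], of k]
      by simp
    finally have 3: "(real m * (dbi v * s ^ m)) ^ k * (c (p M) - p M) \<le> 1" .
    \<comment> \<open>Multiplying the three estimates cancels \<open>dbi v\<close>; the tiling
      contributes s^m per step, b^k and the approach to \<open>q\<close> one factor \<open>s\<close>
      each.\<close>
    have "real m * (s ^ m * s * s) = (real m * (dbi v * s ^ m)) * ((s / dbi v) * s)"
      using lam by simp
    then have "(real m * (s ^ m * s * s)) ^ k * (\<mu> ^ N * e) =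
        (real m * (dbi v * s ^ m)) ^ k * ((s / dbi v) ^ k * (s ^ k * (\<mu> ^ N * e)))"
      by (simp only: power_mult_distrib mult.assoc)
    also have "\<dots> \<le> (real m * (dbi v * s ^ m)) ^ k * ((s / dbi v) ^ k * (x - p N))"
      using 1 lam s by (intro mult_left_mono) auto
    also have "\<dots> \<le> (real m * (dbi v * s ^ m)) ^ k * (c (p M) - p M)"
      using 2 lam s by (intro mult_left_mono) auto
    finally show ?thesis using 3 by simp
  qed
  then show False
    using power_times_unbounded[OF s(3) mult_pos_pos[OF zero_less_power[OF \<mu>(1)] e(1)]] by blast
qed

section \<open>Expanding fixed points of b and the relation a b = b^n a\<close>

lemma expanding_fixed_point_aux:
  assumes x: "x \<in> {0..1}" "x < c x"
  obtains q where "q \<in> {0..1}" "b q = q" "1 < db q"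
proof -
  obtain q where q: "q \<in> {0..1}" "(\<lambda>k. (bi ^^ k) x) \<longlonglongrightarrow> q" "bi q = q"
    using C1_diffeo.funpow_limit[OF b.inverse x(1)] by metis
  have bq: "b q = q" using b.f_g[OF q(1)] q(3) by simp
  have "c q \<noteq> q"
    by (rule limit_moved[OF x q(1,3,2)])
  \<comment> \<open>If \<open>c\<close> moves \<open>q\<close> to the left, its inverse moves
    \<open>q\<close> to the right and the inverse pair applies.\<close>
  then consider "q < c q" | "q < ci q"
    using c.g_greater[OF q(1)] by linarith
  then have "1 < db q"
  proof cases
    case 1
    then show ?thesis by (rule fixed_moved_expanding[OF q(1) bq])
  next
    case 2
    then show ?thesis by (rule C1_affine_pair.fixed_moved_expanding[OF inverse_pair q(1) bq])
  qed
  then show thesis using that q(1) bq by blast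
qed

lemma expanding_fixed_point:
  assumes x: "x \<in> {0..1}" "c x \<noteq> x"
  obtains q where "q \<in> {0..1}" "b q = q" "1 < db q"
proof (cases "x < c x")
  case True
  then show thesis using expanding_fixed_point_aux[OF x(1)] that by blast
next
  case False
  then have "x < ci x" using c.g_greater[OF x(1)] x(2) by simp
  then show thesis
    using C1_affine_pair.expanding_fixed_point_aux[OF inverse_pair x(1)] that by blast
qed

end

text \<open>At a fixed point \<open>q\<close> where b' is maximal and exceeds 1, the fixed point
  a^-1 q of \<open>b\<close> would have derivative (db q)^n > db q.\<close>

lemma no_C1_action:
  assumes pair: "C1_affine_pair b bi db dbi c ci dc dci m"
    and a: "C1_diffeo a ai da dai" and n: "n > 1"
    and rel_ab: "\<And>x. x \<in> {0..1} \<Longrightarrow> a (b x) = (b ^^ n) (a x)"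
    and x: "x \<in> {0..1}"
  shows "c x = x"
proof (rule ccontr)
  assume "c x \<noteq> x"
  interpret C1_affine_pair b bi db dbi c ci dc dci m by (rule pair)
  interpret a: C1_diffeo a ai da dai by (rule a)
  obtain q0 where q0: "q0 \<in> {0..1}" "b q0 = q0" "1 < db q0"
    using expanding_fixed_point[OF x \<open>c x \<noteq> x\<close>] by metis
  \<comment> \<open>The fixed point equation is written as a preimage of 0 to obtain closedness,
    hence compactness, and a maximum of b'.\<close>
  define F where "F = {q \<in> {0..1}. b q - q = 0}"
  have "closed F"
    unfolding F_def
    by (rule continuous_closed_preimage_constant) (intro continuous_intros b.cont_f closed_atLeastAtMost)+
  moreover have "F \<subseteq> {0..1}" by (auto simp: F_def)
  ultimately have "compact F"
    using compact_Int_closed[OF compact_Icc] by (metis inf.absorb2)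
  moreover have "continuous_on F db"
    by (rule continuous_on_subset[OF b.cont_df \<open>F \<subseteq> {0..1}\<close>])
  moreover have "q0 \<in> F" using q0 by (simp add: F_def)
  ultimately obtain q where q: "q \<in> F" "\<And>z. z \<in> F \<Longrightarrow> db z \<le> db q"
    using continuous_attains_sup[of F db] by blast
  have q1: "q \<in> {0..1}" "b q = q" using q(1) by (simp_all add: F_def)
  have dbq: "1 < db q" using q(2)[OF \<open>q0 \<in> F\<close>] q0(3) by simp
  define p where "p = ai q"
  have p: "p \<in> {0..1}" "a p = q"
    using a.g_mem a.f_g q1(1) by (simp_all add: p_def del: atLeastAtMost_iff)
  have "a (b p) = q"
    using rel_ab[OF p(1)] p(2) b.funpow_fixed[OF q1(2)] by simp
  then have bp: "b p = p"
    using a.g_f[OF b.f_mem[OF p(1)]] by (simp add: p_def)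
  have "db p = db q ^ n"
    using deriv_conjugate_power[OF a b.C1_diffeo_axioms rel_ab p(1) bp] p(2) q1(2) by simp
  moreover have "db p \<le> db q"
    using p(1) bp by (intro q(2)) (simp add: F_def)
  ultimately show False
    using power_strict_increasing[OF n dbq] by simp
qed

section \<open>Passage between group elements and maps\<close>

lemma C1_diffeo_of_diff1_plus:
  assumes f: "f \<in> diff1_plus"
  obtains df dg where "C1_diffeo f (inv_into {0..1} f) df dg"
proof -
  have fB: "f \<in> Bij {0..1}" and bij: "bij_betw f {0..1} {0..1}"
    and mono: "strict_mono_on {0..1} f"
    and C1: "C1_on_interval f" "C1_on_interval (inv_into {0..1} f)"
    using f by (auto simp: diff1_plus_def Bij_def)
  obtain df where df: "\<forall>x\<in>{0..1}. (f has_real_derivative df x) (at x within {0..1})"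
    "continuous_on {0..1} df"
    using C1(1) unfolding C1_on_interval_def by blast
  obtain dg where dg: "\<forall>x\<in>{0..1}. (inv_into {0..1} f has_real_derivative dg x) (at x within {0..1})"
    "continuous_on {0..1} dg"
    using C1(2) unfolding C1_on_interval_def by blast
  have "C1_diffeo f (inv_into {0..1} f) df dg"
    by unfold_locales
      (use df dg bij_betwE[OF bij] Bij_inv_into_mem[OF fB] bij_betw_inv_into_left[OF bij]
        bij_betw_inv_into_right[OF bij] strict_mono_onD[OF mono] in blast)+
  then show thesis by (rule that)
qed

lemma mult_Homeo_plus:
  assumes "f \<in> homeo_plus" "g \<in> homeo_plus"
  shows "f \<otimes>\<^bsub>Homeo_plus\<^esub> g = f \<circ> g"
  using assms by (simp add: Homeo_plus_def homeo_plus_def BijGroup_def compose_def fun_eq_iff)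

lemma one_Homeo_plus: "\<one>\<^bsub>Homeo_plus\<^esub> = id"
  by (simp add: Homeo_plus_def BijGroup_def fun_eq_iff)

lemma pow_Homeo_plus:
  assumes f: "f \<in> homeo_plus"
  shows "f [^]\<^bsub>Homeo_plus\<^esub> (k::nat) = f ^^ k"
proof (induction k)
  case 0
  show ?case by (simp add: one_Homeo_plus)
next
  case (Suc k)
  interpret group Homeo_plus by (rule group_Homeo_plus)
  have fc: "f \<in> carrier Homeo_plus" using f by (simp add: Homeo_plus_def)
  have "f [^]\<^bsub>Homeo_plus\<^esub> k \<in> homeo_plus"
    using nat_pow_closed[OF fc] by (simp add: Homeo_plus_def)
  then show ?case
    using mult_Homeo_plus[OF _ f] by (simp add: Suc funpow_swap1 fun_eq_iff)
qed

text \<open>Products in \<open>Diff1_plus\<close> are extensional, so they are compared with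
  compositions only at points of the interval.\<close>

lemma mult_Diff1_plus:
  assumes "f \<in> diff1_plus" "g \<in> diff1_plus" "x \<in> {0..1}"
  shows "(f \<otimes>\<^bsub>Diff1_plus\<^esub> g) x = f (g x)"
  using assms by (simp add: Diff1_plus_def diff1_plus_def BijGroup_def compose_def)

lemma pow_Diff1_plus:
  assumes f: "f \<in> diff1_plus" and x: "x \<in> {0..1}"
  shows "(f [^]\<^bsub>Diff1_plus\<^esub> (k::nat)) x = (f ^^ k) x"
  using x
proof (induction k arbitrary: x)
  case 0
  then show ?case by (simp add: Diff1_plus_def BijGroup_def)
next
  case (Suc k)
  interpret group Diff1_plus by (rule group_Diff1_plus)
  have fc: "f \<in> carrier Diff1_plus" using f by (simp add: Diff1_plus_def)
  have "f [^]\<^bsub>Diff1_plus\<^esub> k \<in> diff1_plus"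
    using nat_pow_closed[OF fc] by (simp add: Diff1_plus_def)
  moreover have "f x \<in> {0..1}"
    using f Suc.prems by (auto simp: diff1_plus_def Bij_def dest: bij_betwE)
  ultimately show ?case
    using mult_Diff1_plus[OF _ f Suc.prems] Suc.IH by (simp add: funpow_swap1)
qed

section \<open>The relations among the generators and the conclusion\<close>

lemma gen_a_gen_b:
  assumes "m > 0"
  shows "gen_a n \<circ> gen_b m = (gen_b m ^^ n) \<circ> gen_a n"
proof -
  have "(gen_b m ^^ k) x = real m ^ k * x" for k x
    by (induction k) (simp_all add: gen_b_def)
  then show ?thesis
    using assms by (simp add: fun_eq_iff gen_a_def gen_b_def abs_mult power_mult_distrib sgn_mult)
qed

lemma gen_b_gen_c: "gen_b m \<circ> gen_c = (gen_c ^^ m) \<circ> gen_b m"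
proof -
  have "(gen_c ^^ k) x = x + real k" for k x
    by (induction k) (simp_all add: gen_c_def)
  then show ?thesis
    by (simp add: fun_eq_iff gen_b_def gen_c_def algebra_simps)
qed

theorem theorem1p13:
  fixes m n :: nat
  assumes "m > 1" and "n > 1"
  shows "\<not> (\<exists>\<phi>. \<phi> \<in> mon (G_mn m n) Diff1_plus)"
proof
  assume "\<exists>\<phi>. \<phi> \<in> mon (G_mn m n) Diff1_plus"
  then obtain \<phi> where hom: "\<phi> \<in> hom (G_mn m n) Diff1_plus"
    and inj: "inj_on \<phi> (carrier (G_mn m n))"
    by (auto simp: mon_def)
  let ?G = "G_mn m n"
  interpret H: group Homeo_plus by (rule group_Homeo_plus)
  interpret D: group Diff1_plus by (rule group_Diff1_plus)
  interpret G: group ?G unfolding G_mn_def by (rule H.group_subgroup_generated)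
  interpret \<phi>: group_hom ?G Diff1_plus \<phi>
    by unfold_locales (rule hom)
  note gens = generators_in_Homeo_plus[OF assms]
  have gen_homeo: "gen_a n \<in> homeo_plus" "gen_b m \<in> homeo_plus" "gen_c \<in> homeo_plus"
    using gens by (simp_all add: Homeo_plus_def)
  have gen_mem: "gen_a n \<in> carrier ?G" "gen_b m \<in> carrier ?G" "gen_c \<in> carrier ?G"
    using gens by (auto simp: G_mn_def carrier_subgroup_generated intro!: generate.incl)
  have pow_homeo: "f ^^ k \<in> homeo_plus" if "f \<in> homeo_plus" for f k
    using that H.nat_pow_closed[of f k] pow_Homeo_plus[OF that, of k] by (simp add: Homeo_plus_def)
  have relG: "g \<otimes>\<^bsub>?G\<^esub> f = f [^]\<^bsub>?G\<^esub> k \<otimes>\<^bsub>?G\<^esub> g"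
    if "g \<circ> f = (f ^^ k) \<circ> g" "f \<in> homeo_plus" "g \<in> homeo_plus" for f g and k :: nat
    using that pow_homeo
    by (simp add: G_mn_def pow_subgroup_generated pow_Homeo_plus mult_Homeo_plus)
  have \<phi>_mem: "\<phi> f \<in> diff1_plus" if "f \<in> carrier ?G" for f
    using \<phi>.hom_closed[OF that] by (simp add: Diff1_plus_def)
  \<comment> \<open>A relation between maps of the line becomes a relation in the group, is carried
    over by \<phi>, and is then read pointwise on the interval.\<close>
  have rel: "\<phi> g (\<phi> f x) = (\<phi> f ^^ k) (\<phi> g x)"
    if r: "g \<circ> f = (f ^^ k) \<circ> g" "f \<in> homeo_plus" "g \<in> homeo_plus"
      and mem: "f \<in> carrier ?G" "g \<in> carrier ?G" and x: "x \<in> {0..1}" for f g x and k :: nat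
  proof -
    have "\<phi> g \<otimes>\<^bsub>Diff1_plus\<^esub> \<phi> f = \<phi> f [^]\<^bsub>Diff1_plus\<^esub> k \<otimes>\<^bsub>Diff1_plus\<^esub> \<phi> g"
      using relG[OF r] mem by (metis G.nat_pow_closed \<phi>.hom_mult \<phi>.hom_nat_pow)
    moreover have "\<phi> f [^]\<^bsub>Diff1_plus\<^esub> k \<in> diff1_plus"
      using \<phi>_mem[OF G.nat_pow_closed[OF mem(1)]] \<phi>.hom_nat_pow[OF mem(1)] by metis
    moreover have "\<phi> g x \<in> {0..1}"
      using \<phi>_mem[OF mem(2)] x by (auto simp: diff1_plus_def Bij_def dest: bij_betwE)
    ultimately show ?thesis
      using mult_Diff1_plus[OF _ _ x] pow_Diff1_plus \<phi>_mem mem by metis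
  qed
  obtain da dai where a: "C1_diffeo (\<phi> (gen_a n)) (inv_into {0..1} (\<phi> (gen_a n))) da dai"
    using C1_diffeo_of_diff1_plus[OF \<phi>_mem[OF gen_mem(1)]] by metis
  obtain db dbi where b: "C1_diffeo (\<phi> (gen_b m)) (inv_into {0..1} (\<phi> (gen_b m))) db dbi"
    using C1_diffeo_of_diff1_plus[OF \<phi>_mem[OF gen_mem(2)]] by metis
  obtain dc dci where c: "C1_diffeo (\<phi> gen_c) (inv_into {0..1} (\<phi> gen_c)) dc dci"
    using C1_diffeo_of_diff1_plus[OF \<phi>_mem[OF gen_mem(3)]] by metis
  have "C1_affine_pair (\<phi> (gen_b m)) (inv_into {0..1} (\<phi> (gen_b m))) db dbi
      (\<phi> gen_c) (inv_into {0..1} (\<phi> gen_c)) dc dci m"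
    using rel[OF gen_b_gen_c] gen_homeo gen_mem assms
    by (intro C1_affine_pair.intro b c C1_affine_pair_axioms.intro) blast+
  then have "\<phi> gen_c x = x" if "x \<in> {0..1}" for x
    using no_C1_action[OF _ a assms(2)] rel[OF gen_a_gen_b[of m n]] assms(1) gen_homeo gen_mem that by blast
  \<comment> \<open>Fixing every point of the interval determines the image of \<open>gen_c\<close>
    only there; extensionality settles the values outside, so it is the unit.\<close>
  moreover have "\<phi> gen_c \<in> extensional {0..1}"
    using \<phi>_mem[OF gen_mem(3)] by (simp add: diff1_plus_def Bij_def)
  ultimately have "\<phi> gen_c = \<one>\<^bsub>Diff1_plus\<^esub>"
    by (auto simp: Diff1_plus_def BijGroup_def fun_eq_iff extensional_def restrict_def)
  \<comment> \<open>Injectivity of \<phi> would make the translation by 1 trivial, which fails at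
    0.\<close>
  then have "gen_c = \<one>\<^bsub>?G\<^esub>"
    using inj_onD[OF inj _ gen_mem(3) G.one_closed] by simp
  then have "gen_c 0 = id 0"
    by (simp add: G_mn_def one_Homeo_plus)
  then show False
    by (simp add: gen_c_def)
qed

end
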